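(* For a set of patterns $\{\rho_1,\rho_2\}$, let $\mathrm{a}_{n,k}^{\mathrm{dasc}}(\rho_1,\rho_2)$ (respectively $\mathrm{a}_{n,k}^{\mathrm{ddes}}(\rho_1,\rho_2)$) denote the number of permutations of $\{1,\dots,n\}$ that avoid both $\rho_1$ and $\rho_2$ and have exactly $k$ double ascents (respectively $k$ double descents). Then for all integers $n,k\ge 0$, $$\mathrm{a}_{n,k}^{\mathrm{dasc}}(132,213)=\mathrm{a}_{n,k}^{\mathrm{ddes}}(132,213)=\mathrm{a}_{n,k}^{\mathrm{dasc}}(213,231)=\mathrm{a}_{n,k}^{\mathrm{ddes}}(213,231),$$ and, as formal power series, $$\sum_{n \geq 0} \sum_{k \geq 0} \mathrm{a}_{n,k}^{\mathrm{ddes}}(132,213)\,q^kz^n=\dfrac{1-qz}{1-z-z^2-qz+qz^2}.$$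
   Context: $\mathcal{S}_n$ is the set of permutations $\pi=\pi_1\cdots\pi_n$ of $\{1,\dots,n\}$; $\mathcal{S}_0$ consists of the empty permutation, which has no double ascents or double descents and avoids every nonempty pattern. For $\rho\in\mathcal{S}_m$, $\pi\in\mathcal{S}_n$ contains $\rho$ if there are indices $1\le i_1<\cdots<i_m\le n$ such that $\pi_{i_a}<\pi_{i_b}$ if and only if $\rho_a<\rho_b$; otherwise $\pi$ avoids $\rho$. The number of double ascents is $\mathrm{dasc}(\pi)=|\{i:\pi_i<\pi_{i+1}<\pi_{i+2}\}|$ and the number of double descents is $\mathrm{ddes}(\pi)=|\{i:\pi_i>\pi_{i+1}>\pi_{i+2}\}|$, where $1\le i\le n-2$. *)

theory Defs
  imports "HOL-Combinatorics.Multiset_Permutations"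
    "HOL-Computational_Algebra.Formal_Power_Series"
begin

text \<open>
  Permutations of \<open>{1..n}\<close> and patterns are lists in one-line notation; the former are the elements
  of \<open>permutations_of_set {1..n}\<close>. List positions start at 0, so the entry \<open>\<pi>\<^sub>i\<close> is \<open>\<pi> ! (i - 1)\<close>.
\<close>

definition contains_pattern :: "nat list \<Rightarrow> nat list \<Rightarrow> bool" where
  "contains_pattern \<pi> \<rho> \<longleftrightarrow>
     (\<exists>i :: nat \<Rightarrow> nat. strict_mono_on {..<length \<rho>} i \<and>
        (\<forall>a<length \<rho>. i a < length \<pi>) \<and>
        (\<forall>a<length \<rho>. \<forall>b<length \<rho>. \<pi> ! i a < \<pi> ! i b \<longleftrightarrow> \<rho> ! a < \<rho> ! b))"

abbreviation avoids_pattern :: "nat list \<Rightarrow> nat list \<Rightarrow> bool" where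
  "avoids_pattern \<pi> \<rho> \<equiv> \<not> contains_pattern \<pi> \<rho>"

definition dasc :: "nat list \<Rightarrow> nat" where
  "dasc \<pi> = card {i. i + 2 < length \<pi> \<and> \<pi> ! i < \<pi> ! (i + 1) \<and> \<pi> ! (i + 1) < \<pi> ! (i + 2)}"

definition ddes :: "nat list \<Rightarrow> nat" where
  "ddes \<pi> = card {i. i + 2 < length \<pi> \<and> \<pi> ! i > \<pi> ! (i + 1) \<and> \<pi> ! (i + 1) > \<pi> ! (i + 2)}"

definition a_dasc :: "nat \<Rightarrow> nat \<Rightarrow> nat list \<Rightarrow> nat list \<Rightarrow> nat" where
  "a_dasc n k \<rho>1 \<rho>2 = card {\<pi> \<in> permutations_of_set {1..n}.
     avoids_pattern \<pi> \<rho>1 \<and> avoids_pattern \<pi> \<rho>2 \<and> dasc \<pi> = k}"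

definition a_ddes :: "nat \<Rightarrow> nat \<Rightarrow> nat list \<Rightarrow> nat list \<Rightarrow> nat" where
  "a_ddes n k \<rho>1 \<rho>2 = card {\<pi> \<in> permutations_of_set {1..n}.
     avoids_pattern \<pi> \<rho>1 \<and> avoids_pattern \<pi> \<rho>2 \<and> ddes \<pi> = k}"

text \<open>
  Bivariate power series are elements of \<open>\<rat>[[q]][[z]]\<close>: the outer variable is \<open>z\<close> and
  the inner one is \<open>q\<close>. Rational rather than integer coefficients are used because the library's
  inverse on power series requires one on the coefficients.
\<close>

definition qvar :: "rat fps fps" where
  "qvar = fps_const fps_X"

definition zvar :: "rat fps fps" where
  "zvar = fps_X"

definition gf2 :: "(nat \<Rightarrow> nat \<Rightarrow> nat) \<Rightarrow> rat fps fps" where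
  "gf2 c = Abs_fps (\<lambda>n. Abs_fps (\<lambda>k. of_nat (c n k)))"

text \<open>
  The coefficient ring \<open>\<rat>[[q]]\<close> is not a field, but division by a series in \<open>z\<close> whose constant
  coefficient is 1 is still the genuine quotient.
\<close>

lemma fps_fps_divide_iff:
  fixes f g h :: "rat fps fps"
  assumes "fps_nth g 0 = 1"
  shows "f = h / g \<longleftrightarrow> f * g = h"
proof -
  have sd: "subdegree g = 0"
    using assms by (simp add: subdegree_eq_0_iff)
  have one: "fps_nth g 0 * inverse (fps_nth g 0) = 1"
    by (simp add: assms)
  have "g * fps_right_inverse g (inverse (fps_nth g 0)) = 1"
    by (rule fps_right_inverse[OF one])
  then have inv: "g * inverse g = 1"
    by (simp only: fps_inverse_def)
  have "h / g = h * inverse g"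
    by (rule fps_divide_unit'[OF sd])
  moreover have "h * inverse g * g = h"
    by (simp only: mult.assoc mult.commute[of "inverse g"] inv mult_1_right)
  moreover have "f * g * inverse g = f"
    by (simp only: mult.assoc inv mult_1_right)
  ultimately show ?thesis
    by auto
qed

end

theory Submission
  imports Defs
begin

text \<open>
  In both classes the comparison of any two entries is determined by the ascents and descents between
  adjacent entries: if \<open>\<pi>\<close> avoids 132 and 213, then \<open>\<pi>\<^sub>i < \<pi>\<^sub>j\<close> for \<open>i < j\<close> exactly when all steps from
  \<open>i\<close> to \<open>j\<close> are ascents; if it avoids 213 and 231, exactly when the single step from \<open>i\<close> to \<open>i + 1\<close> is
  an ascent. Every up-down word of length \<open>n - 1\<close> arises in this way from exactly one permutation
  of each class, so all four numbers count binary words by occurrences of two equal adjacent letters of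
  a fixed kind. Splitting such words by their first two letters gives a linear recurrence and hence
  the generating function.
\<close>

section \<open>Permutations determined by their up-down words\<close>

definition updown :: "nat list \<Rightarrow> bool list" where
  "updown \<pi> = map (\<lambda>i. \<pi> ! i < \<pi> ! Suc i) [0..<length \<pi> - 1]"

lemma length_updown [simp]: "length (updown \<pi>) = length \<pi> - 1"
  by (simp add: updown_def)

lemma nth_updown [simp]: "Suc i < length \<pi> \<Longrightarrow> updown \<pi> ! i \<longleftrightarrow> \<pi> ! i < \<pi> ! Suc i"
  by (simp add: updown_def less_diff_conv)

text \<open>The values below \<open>\<pi> ! i\<close> are exactly
  \<open>1, ..., \<pi> ! i - 1\<close>, each at one position. Hence the comparisons between
  positions determine the permutation, which gives injectivity of \<open>updown\<close>.\<close>

lemma permutation_nth_eq_card: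
  assumes "\<pi> \<in> permutations_of_set {1..n}" "i < n"
  shows "\<pi> ! i = Suc (card {j. j < n \<and> \<pi> ! j < \<pi> ! i})"
proof -
  have len: "length \<pi> = n" and set: "set \<pi> = {1..n}" and dist: "distinct \<pi>"
    using assms(1) by (auto simp: permutations_of_set_def dest: distinct_card)
  have "(\<lambda>j. \<pi> ! j) ` {j. j < n \<and> \<pi> ! j < \<pi> ! i} = {v \<in> set \<pi>. v < \<pi> ! i}"
    using len by (auto simp: set_conv_nth)
  also have "\<dots> = {1..<\<pi> ! i}"
    using set len assms(2) nth_mem[of i \<pi>] by auto
  finally have "card ((\<lambda>j. \<pi> ! j) ` {j. j < n \<and> \<pi> ! j < \<pi> ! i}) = \<pi> ! i - 1"
    by simp
  moreover have "inj_on (\<lambda>j. \<pi> ! j) {j. j < n \<and> \<pi> ! j < \<pi> ! i}"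
    using dist len by (auto simp: inj_on_def nth_eq_iff_index_eq)
  ultimately have "card {j. j < n \<and> \<pi> ! j < \<pi> ! i} = \<pi> ! i - 1"
    by (simp add: card_image)
  moreover have "\<pi> ! i \<ge> 1"
    using set len assms(2) nth_mem[of i \<pi>] by auto
  ultimately show ?thesis by simp
qed

text \<open>Each position receives its rank, one more than the number of its predecessors under
  \<open>L\<close>.\<close>

lemma permutation_of_linear_order_exists:
  fixes L :: "nat \<Rightarrow> nat \<Rightarrow> bool"
  assumes irrefl: "\<And>i. \<not> L i i"
    and trans: "\<And>i j k. i < n \<Longrightarrow> j < n \<Longrightarrow> k < n \<Longrightarrow> L i j \<Longrightarrow> L j k \<Longrightarrow> L i k"
    and total: "\<And>i j. i < n \<Longrightarrow> j < n \<Longrightarrow> i \<noteq> j \<Longrightarrow> L i j \<or> L j i"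
  shows "\<exists>\<pi> \<in> permutations_of_set {1..n}. \<forall>i<n. \<forall>j<n. \<pi> ! i < \<pi> ! j \<longleftrightarrow> L i j"
proof -
  define r where "r = (\<lambda>i. Suc (card {j. j < n \<and> L j i}))"
  have mono: "r i < r j" if "L i j" "i < n" "j < n" for i j
  proof -
    \<comment> \<open>Transitivity gives the inclusion; it is strict because \<open>i\<close> itself
      lies only in the right-hand set.\<close>
    have "{k. k < n \<and> L k i} \<subset> {k. k < n \<and> L k j}"
      using that irrefl trans by blast
    then show ?thesis unfolding r_def by (auto intro: psubset_card_mono)
  qed
  have less_iff: "r i < r j \<longleftrightarrow> L i j" if "i < n" "j < n" for i j
    using mono[OF _ that] mono[OF _ that(2,1)] total[OF that] by (metis less_asym less_irrefl)
  have inj: "inj_on r {..<n}"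
    unfolding inj_on_def by (metis lessThan_iff less_irrefl mono total)
  have "r i \<in> {1..n}" if "i < n" for i
  proof -
    have "{j. j < n \<and> L j i} \<subset> {..<n}"
      using irrefl that by auto
    then have "card {j. j < n \<and> L j i} < card {..<n}"
      by (intro psubset_card_mono) auto
    then show ?thesis by (simp add: r_def)
  qed
  then have "r ` {..<n} = {1..n}"
    by (intro card_subset_eq) (auto simp: card_image[OF inj])
  then have "map r [0..<n] \<in> permutations_of_set {1..n}"
    using inj by (simp add: permutations_of_set_def distinct_map atLeast0LessThan)
  moreover have "\<forall>i<n. \<forall>j<n. map r [0..<n] ! i < map r [0..<n] ! j \<longleftrightarrow> L i j"
    by (simp add: less_iff)
  ultimately show ?thesis by blast
qed

text \<open>\<open>K w i j\<close> is the rule by which a word \<open>w\<close> decides the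
  comparison of positions \<open>i < j\<close>. Transitivity of \<open>K\<close> and of its negation
  turns any word into a linear order on positions, and \<open>K_Suc\<close> recovers the word from
  it. Both classes are instances.\<close>

lemma bij_betw_updown:
  fixes Q :: "nat list \<Rightarrow> bool" and K :: "bool list \<Rightarrow> nat \<Rightarrow> nat \<Rightarrow> bool"
  assumes Q_iff: "\<And>\<pi>. distinct \<pi> \<Longrightarrow>
      Q \<pi> \<longleftrightarrow> (\<forall>j<length \<pi>. \<forall>i<j. \<pi> ! i < \<pi> ! j \<longleftrightarrow> K (updown \<pi>) i j)"
    and K_Suc: "\<And>w i. K w i (Suc i) \<longleftrightarrow> w ! i"
    and K_trans: "\<And>w i j k. i < j \<Longrightarrow> j < k \<Longrightarrow> K w i j \<Longrightarrow> K w j k \<Longrightarrow> K w i k"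
    and not_K_trans: "\<And>w i j k. i < j \<Longrightarrow> j < k \<Longrightarrow> \<not> K w i j \<Longrightarrow> \<not> K w j k \<Longrightarrow> \<not> K w i k"
  shows "bij_betw updown {\<pi> \<in> permutations_of_set {1..n}. Q \<pi>} {w. length w = n - 1}"
proof -
  have perm: "distinct \<pi>" "length \<pi> = n" if "\<pi> \<in> permutations_of_set {1..n}" for \<pi>
    using that by (auto simp: permutations_of_set_def dest: distinct_card)
  \<comment> \<open>\<open>K\<close> is only consulted for increasing positions; \<open>L\<close>
    extends it to all pairs by reversing the answer when the positions are swapped.\<close>
  define L where "L = (\<lambda>w i j. i < j \<and> K w i j \<or> j < i \<and> \<not> K w j i)"
  have less_iff: "\<pi> ! i < \<pi> ! j \<longleftrightarrow> L (updown \<pi>) i j"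
    if "\<pi> \<in> permutations_of_set {1..n}" "Q \<pi>" "i < n" "j < n" for \<pi> i j
  proof (cases i j rule: linorder_cases)
    case greater
    have "\<pi> ! i \<noteq> \<pi> ! j"
      using perm[OF that(1)] that greater by (simp add: nth_eq_iff_index_eq)
    moreover have "\<pi> ! j < \<pi> ! i \<longleftrightarrow> K (updown \<pi>) j i"
      using Q_iff[OF perm(1)[OF that(1)]] that greater perm(2)[OF that(1)] by simp
    ultimately show ?thesis using greater by (auto simp: L_def)
  qed (use Q_iff[OF perm(1)[OF that(1)]] that perm(2)[OF that(1)] in \<open>auto simp: L_def\<close>)
  have "inj_on updown {\<pi> \<in> permutations_of_set {1..n}. Q \<pi>}"
  proof (rule inj_onI, clarify)
    fix \<pi> \<sigma> assume P: "\<pi> \<in> permutations_of_set {1..n}" "Q \<pi>"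
      and S: "\<sigma> \<in> permutations_of_set {1..n}" "Q \<sigma>" and eq: "updown \<pi> = updown \<sigma>"
    have "\<pi> ! i = \<sigma> ! i" if "i < n" for i
    proof -
      have "{j. j < n \<and> \<pi> ! j < \<pi> ! i} = {j. j < n \<and> \<sigma> ! j < \<sigma> ! i}"
        using less_iff[OF P] less_iff[OF S] eq that by auto
      then show ?thesis
        using permutation_nth_eq_card[OF P(1) that] permutation_nth_eq_card[OF S(1) that] by simp
    qed
    then show "\<pi> = \<sigma>"
      using perm(2)[OF P(1)] perm(2)[OF S(1)] by (simp add: nth_equalityI)
  qed
  moreover have "updown ` {\<pi> \<in> permutations_of_set {1..n}. Q \<pi>} = {w. length w = n - 1}"
  proof (intro equalityI subsetI)
    fix w :: "bool list" assume "w \<in> {w. length w = n - 1}"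
    then have len: "length w = n - 1" by simp
    \<comment> \<open>If \<open>j\<close> lies between \<open>i\<close> and \<open>k\<close>, one of
      the two transitivity laws applies directly. If \<open>j\<close> is the largest or smallest
      position, a wrong comparison of \<open>i\<close> and \<open>k\<close> combines with one
      assumption to contradict the other.\<close>
    have trans: "L w i k" if "L w i j" "L w j k" for i j k
      using that unfolding L_def
    proof (elim disjE conjE)
      assume "i < j" "K w i j" "j < k" "K w j k"
      then show "i < k \<and> K w i k \<or> k < i \<and> \<not> K w k i"
        using K_trans[of i j k w] by simp
    next
      assume "i < j" "K w i j" "k < j" "\<not> K w k j"
      then show "i < k \<and> K w i k \<or> k < i \<and> \<not> K w k i"
        using not_K_trans[of i k j w] K_trans[of k i j w]
        by (cases i k rule: linorder_cases) blast+
    next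
      assume "j < i" "\<not> K w j i" "j < k" "K w j k"
      then show "i < k \<and> K w i k \<or> k < i \<and> \<not> K w k i"
        using not_K_trans[of j i k w] K_trans[of j k i w]
        by (cases i k rule: linorder_cases) blast+
    next
      assume "j < i" "\<not> K w j i" "k < j" "\<not> K w k j"
      then show "i < k \<and> K w i k \<or> k < i \<and> \<not> K w k i"
        using not_K_trans[of k j i w] by simp
    qed
    have "\<exists>\<pi> \<in> permutations_of_set {1..n}. \<forall>i<n. \<forall>j<n. \<pi> ! i < \<pi> ! j \<longleftrightarrow> L w i j"
    proof (rule permutation_of_linear_order_exists)
      show "\<not> L w i i" and "i \<noteq> j \<Longrightarrow> L w i j \<or> L w j i" for i j
        by (auto simp: L_def)
    qed (rule trans)
    then obtain \<pi> where \<pi>: "\<pi> \<in> permutations_of_set {1..n}"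
      and less: "\<forall>i<n. \<forall>j<n. \<pi> ! i < \<pi> ! j \<longleftrightarrow> L w i j"
      by blast
    have w: "updown \<pi> = w"
      using perm(2)[OF \<pi>] len less by (intro nth_equalityI) (auto simp: L_def K_Suc)
    have "Q \<pi>"
      using Q_iff[OF perm(1)[OF \<pi>]] perm(2)[OF \<pi>] less w by (auto simp: L_def)
    then show "w \<in> updown ` {\<pi> \<in> permutations_of_set {1..n}. Q \<pi>}"
      using \<pi> w by blast
  qed (use perm in auto)
  ultimately show ?thesis by (simp add: bij_betw_def)
qed

section \<open>The two avoidance classes\<close>

lemma contains_pattern_length3_iff:
  "contains_pattern \<pi> [a, b, c] \<longleftrightarrow>
     (\<exists>k<length \<pi>. \<exists>j<k. \<exists>i<j.
        (\<pi> ! i < \<pi> ! j \<longleftrightarrow> a < b) \<and> (\<pi> ! j < \<pi> ! i \<longleftrightarrow> b < a) \<and>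
        (\<pi> ! i < \<pi> ! k \<longleftrightarrow> a < c) \<and> (\<pi> ! k < \<pi> ! i \<longleftrightarrow> c < a) \<and>
        (\<pi> ! j < \<pi> ! k \<longleftrightarrow> b < c) \<and> (\<pi> ! k < \<pi> ! j \<longleftrightarrow> c < b))"
  (is "_ \<longleftrightarrow> ?R")
proof
  assume "contains_pattern \<pi> [a, b, c]"
  then obtain f where "strict_mono_on {..<3} f" "\<forall>x<3. f x < length \<pi>"
    and f: "\<forall>x<3. \<forall>y<3. \<pi> ! f x < \<pi> ! f y \<longleftrightarrow> [a, b, c] ! x < [a, b, c] ! y"
    by (auto simp: contains_pattern_def numeral_3_eq_3)
  then have "f 0 < f 1" "f 1 < f 2" "f 2 < length \<pi>"
    by (auto intro: strict_mono_onD)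
  with f show ?R
    by (intro exI[of _ "f 2"] conjI exI[of _ "f 1"] exI[of _ "f 0"])
      (simp_all add: numeral_3_eq_3 numeral_2_eq_2 All_less_Suc)
next
  assume ?R
  then obtain i j k where "i < j" "j < k" "k < length \<pi>"
    "(\<pi> ! i < \<pi> ! j \<longleftrightarrow> a < b)" "(\<pi> ! j < \<pi> ! i \<longleftrightarrow> b < a)"
    "(\<pi> ! i < \<pi> ! k \<longleftrightarrow> a < c)" "(\<pi> ! k < \<pi> ! i \<longleftrightarrow> c < a)"
    "(\<pi> ! j < \<pi> ! k \<longleftrightarrow> b < c)" "(\<pi> ! k < \<pi> ! j \<longleftrightarrow> c < b)"
    by blast
  then show "contains_pattern \<pi> [a, b, c]"
    unfolding contains_pattern_def
    by (intro exI[of _ "\<lambda>x. if x = 0 then i else if x = 1 then j else k"])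
      (auto simp: strict_mono_on_def All_less_Suc less_Suc_eq)
qed

text \<open>For a concrete pattern the six comparisons collapse to a chain of two inequalities;
  likewise for the next two patterns.\<close>

lemma contains_132_iff:
  "contains_pattern \<pi> [1, 3, 2] \<longleftrightarrow>
     (\<exists>k<length \<pi>. \<exists>j<k. \<exists>i<j. \<pi> ! i < \<pi> ! k \<and> \<pi> ! k < \<pi> ! j)"
  unfolding contains_pattern_length3_iff by ((rule ex_cong1, rule conj_cong[OF refl])+, auto)

lemma contains_213_iff:
  "contains_pattern \<pi> [2, 1, 3] \<longleftrightarrow>
     (\<exists>k<length \<pi>. \<exists>j<k. \<exists>i<j. \<pi> ! j < \<pi> ! i \<and> \<pi> ! i < \<pi> ! k)"
  unfolding contains_pattern_length3_iff by ((rule ex_cong1, rule conj_cong[OF refl])+, auto)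

lemma contains_231_iff:
  "contains_pattern \<pi> [2, 3, 1] \<longleftrightarrow>
     (\<exists>k<length \<pi>. \<exists>j<k. \<exists>i<j. \<pi> ! k < \<pi> ! i \<and> \<pi> ! i < \<pi> ! j)"
  unfolding contains_pattern_length3_iff by ((rule ex_cong1, rule conj_cong[OF refl])+, auto)

text \<open>Suppose \<open>\<pi> ! i < \<pi> ! j\<close> with a descent at \<open>m\<close> in
  between. Avoiding 213 at \<open>m, m + 1, j\<close> puts \<open>\<pi> ! j\<close> below
  \<open>\<pi> ! m\<close>, and then \<open>i, m, j\<close> form a 132.\<close>

lemma avoids_132_213_iff:
  assumes "distinct \<pi>"
  shows "avoids_pattern \<pi> [1, 3, 2] \<and> avoids_pattern \<pi> [2, 1, 3] \<longleftrightarrow>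
    (\<forall>j<length \<pi>. \<forall>i<j. \<pi> ! i < \<pi> ! j \<longleftrightarrow> (\<forall>m\<in>{i..<j}. updown \<pi> ! m))"
    (is "?A \<longleftrightarrow> ?B")
proof
  assume ?A
  then have no132: "\<not> (\<pi> ! i < \<pi> ! k \<and> \<pi> ! k < \<pi> ! j)"
    and no213: "\<not> (\<pi> ! j < \<pi> ! i \<and> \<pi> ! i < \<pi> ! k)"
    if "i < j" "j < k" "k < length \<pi>" for i j k
    using that unfolding contains_132_iff contains_213_iff by blast+
  show ?B
  proof (intro allI impI iffI ballI)
    fix i j m assume j: "j < length \<pi>" "i < j" and less: "\<pi> ! i < \<pi> ! j" and m: "m \<in> {i..<j}"
    show "updown \<pi> ! m"
    proof (rule ccontr)
      assume "\<not> updown \<pi> ! m"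
      moreover have "\<pi> ! m \<noteq> \<pi> ! Suc m"
        using assms j m by (simp add: nth_eq_iff_index_eq)
      ultimately have desc: "\<pi> ! Suc m < \<pi> ! m"
        using j m by simp
      then have "\<not> \<pi> ! m < \<pi> ! j"
        using no213[of m "Suc m" j] j m by (cases "Suc m = j") auto
      moreover have "\<pi> ! m \<noteq> \<pi> ! j"
        using assms j m by (simp add: nth_eq_iff_index_eq)
      ultimately have "\<pi> ! j < \<pi> ! m" by simp
      then show False
        using no132[of i m j] less j m by (cases "i = m") auto
    qed
  next
    fix i j assume j: "j < length \<pi>" "i < j" and "\<forall>m\<in>{i..<j}. updown \<pi> ! m"
    then have "\<pi> ! m < \<pi> ! Suc m" if "i \<le> m" "m < j" for m
      using that by auto
    then show "\<pi> ! i < \<pi> ! j"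
      using \<open>i < j\<close>
    proof (induction j)
      case (Suc j)
      then show ?case
        by (cases "i = j") (auto intro: less_trans)
    qed simp
  qed
next
  assume ?B
  then have less_iff: "\<pi> ! i < \<pi> ! j \<longleftrightarrow> (\<forall>m\<in>{i..<j}. updown \<pi> ! m)"
    if "i < j" "j < length \<pi>" for i j
    using that by blast
  \<comment> \<open>Both patterns rise from first to last letter while the middle letter lies
    outside that range, which this excludes.\<close>
  have "\<pi> ! i < \<pi> ! j \<and> \<pi> ! j < \<pi> ! k" if "i < j" "j < k" "k < length \<pi>" "\<pi> ! i < \<pi> ! k" for i j k
    using that less_iff[of i j] less_iff[of j k] less_iff[of i k] by auto
  then show ?A
    unfolding contains_132_iff contains_213_iff by (meson less_asym)
qed

text \<open>In both patterns the first letter has the middle value. Avoiding them means that all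
  entries after \<open>\<pi> ! i\<close> lie on the same side of it, namely that of its right
  neighbour.\<close>

lemma avoids_213_231_iff:
  assumes "distinct \<pi>"
  shows "avoids_pattern \<pi> [2, 1, 3] \<and> avoids_pattern \<pi> [2, 3, 1] \<longleftrightarrow>
    (\<forall>j<length \<pi>. \<forall>i<j. \<pi> ! i < \<pi> ! j \<longleftrightarrow> updown \<pi> ! i)"
    (is "?A \<longleftrightarrow> ?B")
proof
  assume ?A
  then have no213: "\<not> (\<pi> ! j < \<pi> ! i \<and> \<pi> ! i < \<pi> ! k)"
    and no231: "\<not> (\<pi> ! k < \<pi> ! i \<and> \<pi> ! i < \<pi> ! j)"
    if "i < j" "j < k" "k < length \<pi>" for i j k
    using that unfolding contains_213_iff contains_231_iff by blast+
  show ?B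
  proof (intro allI impI)
    fix i j assume j: "j < length \<pi>" "i < j"
    have "\<pi> ! i \<noteq> \<pi> ! j" "\<pi> ! i \<noteq> \<pi> ! Suc i"
      using assms j by (simp_all add: nth_eq_iff_index_eq)
    then show "\<pi> ! i < \<pi> ! j \<longleftrightarrow> updown \<pi> ! i"
      using no213[of i "Suc i" j] no231[of i "Suc i" j] j by (cases "j = Suc i") auto
  qed
next
  assume ?B
  then have "\<pi> ! i < \<pi> ! j \<longleftrightarrow> \<pi> ! i < \<pi> ! k" if "i < j" "j < k" "k < length \<pi>" for i j k
    using that by (meson less_trans)
  then show ?A
    unfolding contains_213_iff contains_231_iff by (meson less_asym)
qed

section \<open>Counting words\<close>

definition adjacent :: "'a \<Rightarrow> 'a list \<Rightarrow> nat" where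
  "adjacent b w = card {i. Suc i < length w \<and> w ! i = b \<and> w ! Suc i = b}"

lemma adjacent_Nil [simp]: "adjacent b [] = 0"
  and adjacent_single [simp]: "adjacent b [x] = 0"
  by (simp_all add: adjacent_def)

lemma adjacent_Cons_Cons [simp]:
  "adjacent b (x # y # w) = of_bool (x = b \<and> y = b) + adjacent b (y # w)"
proof -
  let ?S = "{i. Suc i < length (y # w) \<and> (y # w) ! i = b \<and> (y # w) ! Suc i = b}"
  have "{i. Suc i < length (x # y # w) \<and> (x # y # w) ! i = b \<and> (x # y # w) ! Suc i = b} =
      (if x = b \<and> y = b then {0} else {}) \<union> Suc ` ?S" (is "?T = _")
  proof (rule set_eqI)
    fix i show "i \<in> ?T \<longleftrightarrow> i \<in> (if x = b \<and> y = b then {0} else {}) \<union> Suc ` ?S"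
      by (cases i) auto
  qed
  moreover have "finite ?S" by simp
  ultimately show ?thesis
    by (auto simp: adjacent_def card_insert_if card_image)
qed

lemma adjacent_map_Not: "adjacent b (map Not w) = adjacent (\<not> b) w"
  unfolding adjacent_def by (rule arg_cong[of _ _ card]) auto

lemma dasc_eq_adjacent: "dasc \<pi> = adjacent True (updown \<pi>)"
  unfolding dasc_def adjacent_def by (rule arg_cong[of _ _ card]) auto

text \<open>The letter \<open>False\<close> only says that a step is not an ascent; distinctness
  makes it a descent.\<close>

lemma ddes_eq_adjacent:
  assumes "distinct \<pi>"
  shows "ddes \<pi> = adjacent False (updown \<pi>)"
proof -
  have "\<pi> ! Suc i < \<pi> ! i \<longleftrightarrow> \<not> \<pi> ! i < \<pi> ! Suc i" if "Suc i < length \<pi>" for i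
    using nth_eq_iff_index_eq[OF assms, of i "Suc i"] that by auto
  then show ?thesis
    unfolding ddes_def adjacent_def by (intro arg_cong[of _ _ card]) auto
qed

lemma bij_betw_card_fibre:
  assumes "bij_betw f {x \<in> X. Q x} Y" and "\<And>x. x \<in> X \<Longrightarrow> s x = t (f x)"
  shows "card {x \<in> X. Q x \<and> s x = k} = card {y \<in> Y. t y = k}"
proof (rule bij_betw_same_card)
  show "bij_betw f {x \<in> X. Q x \<and> s x = k} {y \<in> Y. t y = k}"
    using assms unfolding bij_betw_def inj_on_def by (auto simp: image_iff)
qed

definition word_count :: "nat \<Rightarrow> nat \<Rightarrow> nat" where
  "word_count n k = card {w. length w = n \<and> adjacent False w = k}"

text \<open>Complementing every letter exchanges the two kinds of adjacent pairs.\<close>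

lemma word_count_True: "card {w. length w = n \<and> adjacent True w = k} = word_count n k"
proof -
  have "bij_betw (map Not) {w. length w = n \<and> adjacent True w = k}
      {w. length w = n \<and> adjacent False w = k}"
    by (rule bij_betw_byWitness[where f' = "map Not"]) (auto simp: adjacent_map_Not comp_def)
  then show ?thesis
    unfolding word_count_def by (rule bij_betw_same_card)
qed

lemma card_updown_fibres:
  assumes "bij_betw updown {\<pi> \<in> permutations_of_set {1..n}. Q \<pi>} {w. length w = n - 1}"
  shows "card {\<pi> \<in> permutations_of_set {1..n}. Q \<pi> \<and> dasc \<pi> = k} = word_count (n - 1) k"
    and "card {\<pi> \<in> permutations_of_set {1..n}. Q \<pi> \<and> ddes \<pi> = k} = word_count (n - 1) k"
  using bij_betw_card_fibre[OF assms, of dasc "adjacent True" k]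
    bij_betw_card_fibre[OF assms, of ddes "adjacent False" k]
  by (auto simp: dasc_eq_adjacent ddes_eq_adjacent permutations_of_set_def word_count_True)
    (simp add: word_count_def)

text \<open>
  The truncated subtraction is harmless at \<open>n = 0\<close>: the empty permutation, like the only permutation
  of length 1, has the empty up-down word.
\<close>
lemma pattern_counts_eq_word_count:
  "a_dasc n k [1,3,2] [2,1,3] = word_count (n - 1) k"
  "a_ddes n k [1,3,2] [2,1,3] = word_count (n - 1) k"
  "a_dasc n k [2,1,3] [2,3,1] = word_count (n - 1) k"
  "a_ddes n k [2,1,3] [2,3,1] = word_count (n - 1) k"
proof -
  have "bij_betw updown
      {\<pi> \<in> permutations_of_set {1..n}. avoids_pattern \<pi> [1,3,2] \<and> avoids_pattern \<pi> [2,1,3]}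
      {w. length w = n - 1}"
  proof (rule bij_betw_updown[where K = "\<lambda>w i j. \<forall>m\<in>{i..<j}. w ! m"], erule avoids_132_213_iff)
    fix w :: "bool list" and i j k :: nat
    show "(\<forall>m\<in>{i..<Suc i}. w ! m) \<longleftrightarrow> w ! i"
      by simp
    assume "i < j" "j < k"
    \<comment> \<open>The rule for \<open>i, k\<close> becomes the conjunction of those for
      \<open>i, j\<close> and \<open>j, k\<close>, so both transitivity conditions follow.\<close>
    then have "{i..<k} = {i..<j} \<union> {j..<k}"
      by auto
    then show "\<forall>m\<in>{i..<j}. w ! m \<Longrightarrow> \<forall>m\<in>{j..<k}. w ! m \<Longrightarrow> \<forall>m\<in>{i..<k}. w ! m"
      and "\<not> (\<forall>m\<in>{i..<j}. w ! m) \<Longrightarrow> \<not> (\<forall>m\<in>{j..<k}. w ! m) \<Longrightarrow> \<not> (\<forall>m\<in>{i..<k}. w ! m)"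
      by blast+
  qed
  from card_updown_fibres[OF this]
  show "a_dasc n k [1,3,2] [2,1,3] = word_count (n - 1) k"
    "a_ddes n k [1,3,2] [2,1,3] = word_count (n - 1) k"
    by (simp_all add: a_dasc_def a_ddes_def conj_assoc)
  have "bij_betw updown
      {\<pi> \<in> permutations_of_set {1..n}. avoids_pattern \<pi> [2,1,3] \<and> avoids_pattern \<pi> [2,3,1]}
      {w. length w = n - 1}"
    by (rule bij_betw_updown[where K = "\<lambda>w i j. w ! i"], erule avoids_213_231_iff) auto
  from card_updown_fibres[OF this]
  show "a_dasc n k [2,1,3] [2,3,1] = word_count (n - 1) k"
    "a_ddes n k [2,1,3] [2,3,1] = word_count (n - 1) k"
    by (simp_all add: a_dasc_def a_ddes_def conj_assoc)
qed

section \<open>The generating function\<close>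

text \<open>The row polynomial in \<open>q\<close>: \<open>fps_X\<close> is here the inner variable.
  As a sum over words it can be split by first letters.\<close>

definition word_gf :: "nat \<Rightarrow> rat fps" where
  "word_gf n = (\<Sum>w | length w = n. fps_X ^ adjacent False w)"

lemma finite_bool_words [simp]: "finite {w :: bool list. length w = n \<and> P w}"
  by (rule finite_subset[OF _ finite_lists_length_eq[of UNIV n]]) auto

lemma finite_bool_words' [simp]: "finite {w :: bool list. length w = n}"
  using finite_bool_words[of n "\<lambda>_. True"] by simp

lemma fps_nth_word_gf: "fps_nth (word_gf n) k = of_nat (word_count n k)"
proof -
  have "fps_nth (word_gf n) k = (\<Sum>w | length w = n. if adjacent False w = k then 1 else 0)"
    unfolding word_gf_def fps_sum_nth by (intro sum.cong) (auto simp: fps_X_power_nth)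
  also have "\<dots> = of_nat (word_count n k)"
    unfolding word_count_def by (simp add: sum.If_cases Collect_conj_eq)
  finally show ?thesis .
qed

lemma sum_bool_words_Suc:
  fixes f :: "bool list \<Rightarrow> 'a::comm_monoid_add"
  shows "(\<Sum>w | length w = Suc n. f w) = (\<Sum>w | length w = n. f (True # w) + f (False # w))"
proof -
  have "{w. length w = Suc n} = (#) True ` {w. length w = n} \<union> (#) False ` {w. length w = n}"
    by (auto simp: length_Suc_conv image_iff)
  then have "(\<Sum>w | length w = Suc n. f w) =
      sum f ((#) True ` {w. length w = n}) + sum f ((#) False ` {w. length w = n})"
    by (simp, intro sum.union_disjoint) auto
  then show ?thesis
    by (simp add: sum.reindex sum.distrib)
qed

lemma word_gf_0: "word_gf 0 = 1"
  by (simp add: word_gf_def)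

lemma word_gf_1: "word_gf (Suc 0) = 2"
  by (simp add: word_gf_def sum_bool_words_Suc)

lemma adjacent_Cons_neq: "x \<noteq> b \<Longrightarrow> adjacent b (x # w) = adjacent b w"
  by (cases w) auto

text \<open>
  The words of length \<open>n + 1\<close> that start with \<open>False\<close> contribute \<open>word_gf (n + 1) - word_gf n\<close>;
  a further \<open>False\<close> in front of them creates one new adjacent pair.
\<close>
lemma word_gf_Suc_Suc:
  "word_gf (Suc (Suc n)) =
     word_gf (Suc n) + word_gf n + fps_X * (word_gf (Suc n) - word_gf n)"
proof -
  have F: "word_gf (Suc m) = word_gf m + (\<Sum>w | length w = m. fps_X ^ adjacent False (False # w))"
    for m
    unfolding word_gf_def sum_bool_words_Suc by (simp add: sum.distrib adjacent_Cons_neq)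
  \<comment> \<open>A second letter \<open>True\<close> ends the initial run and leaves
    \<open>word_gf n\<close>; a second letter \<open>False\<close> completes a pair and yields the
    factor \<open>fps_X\<close>.\<close>
  have "(\<Sum>w | length w = Suc n. fps_X ^ adjacent False (False # w)) =
      word_gf n + fps_X * (\<Sum>w | length w = n. fps_X ^ adjacent False (False # w))"
    unfolding word_gf_def sum_bool_words_Suc
    by (simp add: sum.distrib sum_distrib_left adjacent_Cons_neq)
  with F[of "Suc n"] F[of n] show ?thesis
    by (simp add: algebra_simps)
qed

lemma gf2_word_count:
  "gf2 (\<lambda>n k. word_count (n - 1) k) = Abs_fps (\<lambda>n. word_gf (n - 1))"
  unfolding gf2_def by (simp add: fps_eq_iff fps_nth_word_gf)

lemma gf2_word_count_eq:
  "gf2 (\<lambda>n k. word_count (n - 1) k) =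
     (1 - qvar * zvar) / (1 - zvar - zvar^2 - qvar * zvar + qvar * zvar^2)"
proof -
  define G where "G = Abs_fps (\<lambda>n. word_gf (n - 1))"
  \<comment> \<open>The coefficients of \<open>G\<close> at 0 and 1 are both
    \<open>word_gf 0 = 1\<close>, so the recurrence already holds at \<open>n = 0\<close>, where it
    reads \<open>2 = 1 + 1 + q * (1 - 1)\<close>.\<close>
  have rec: "fps_nth G (Suc (Suc n)) =
      fps_nth G (Suc n) + fps_nth G n + fps_X * (fps_nth G (Suc n) - fps_nth G n)" for n
    by (cases n) (simp_all add: G_def word_gf_Suc_Suc word_gf_0 word_gf_1)
  \<comment> \<open>Powers of \<open>z\<close> are written as repeated factors \<open>fps_X\<close>,
    so that taking coefficients becomes an index shift.\<close>
  have "G * (1 - zvar - zvar^2 - qvar * zvar + qvar * zvar^2) =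
      G - fps_X * G - fps_X * (fps_X * G) - fps_const fps_X * (fps_X * G)
        + fps_const fps_X * (fps_X * (fps_X * G))"
    by (simp add: zvar_def qvar_def algebra_simps power2_eq_square)
  also have "\<dots> = 1 - qvar * zvar"
  \<comment> \<open>From \<open>n = 2\<close> on the coefficients vanish by \<open>rec\<close>; the
    first two are \<open>1\<close> and \<open>1 - 1 - q\<close>, the numerator.\<close>
  proof (rule fps_ext)
    fix n
    consider "n = 0" | "n = 1" | m where "n = Suc (Suc m)"
      by (metis One_nat_def not0_implies_Suc)
    then show "fps_nth (G - fps_X * G - fps_X * (fps_X * G) - fps_const fps_X * (fps_X * G)
        + fps_const fps_X * (fps_X * (fps_X * G))) n = fps_nth (1 - qvar * zvar) n"
    proof cases
      case 3
      then show ?thesis by (simp add: rec qvar_def zvar_def algebra_simps)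
    qed (simp_all add: G_def word_gf_0 qvar_def zvar_def)
  qed
  finally show ?thesis
    unfolding gf2_word_count G_def[symmetric]
    by (subst fps_fps_divide_iff) (simp_all add: zvar_def qvar_def)
qed

theorem proposition11:
  shows "(\<forall>n k.
      a_dasc n k [1,3,2] [2,1,3] = a_ddes n k [1,3,2] [2,1,3] \<and>
      a_ddes n k [1,3,2] [2,1,3] = a_dasc n k [2,1,3] [2,3,1] \<and>
      a_dasc n k [2,1,3] [2,3,1] = a_ddes n k [2,1,3] [2,3,1]) \<and>
    gf2 (\<lambda>n k. a_ddes n k [1,3,2] [2,1,3]) =
      (1 - qvar * zvar) / (1 - zvar - zvar^2 - qvar * zvar + qvar * zvar^2)"
  by (simp only: pattern_counts_eq_word_count gf2_word_count_eq simp_thms)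

end
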